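(* For each prime $p$, $$\limsup_{n \to \infty} \frac{\mathrm{ord}_p(\overline{G}_n)}{n \log_p n} = 1.$$
   Context: $\overline{G}_n := \prod_{t=0}^n \binom{n}{t}$. For a prime $p$ and a positive integer $m$, $\mathrm{ord}_p(m)$ is the exponent of the largest power of $p$ dividing $m$; $\log_p$ is the logarithm to base $p$. *)

theory Defs
  imports "HOL-Library.Extended_Real" "HOL-Computational_Algebra.Primes"
begin

definition binomial_product :: "nat \<Rightarrow> nat" where
  "binomial_product n = (\<Prod>t=0..n. n choose t)"

end

theory Submission
  imports Defs
begin

text \<open>
  Write \<open>v\<close> for the multiplicity of \<open>p\<close>. Counting carries (here, Legendre's formula for
  \<open>v (n!)\<close>) shows that no binomial coefficient of row \<open>n\<close> is divisible by a power of \<open>p\<close> larger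
  than \<open>n\<close>. Apart from the entry \<open>1\<close> at \<open>t = 0\<close>, the row has \<open>n\<close> entries, so
  \<open>v (binomial_product n) \<le> n log\<^sub>p n\<close> and the limsup is at most \<open>1\<close>.

  Rows with \<open>n = p ^ k\<close> almost attain this bound. The identity
  \<open>t (n choose t) = n (n - 1 choose t - 1)\<close> gives \<open>v (n choose t) \<ge> k - v t\<close>, and the total
  deficit over \<open>t = 1, \<dots>, n\<close> is \<open>v (n!) \<le> n\<close>, again by Legendre. Hence
  \<open>v (binomial_product n) \<ge> (k - 1) n\<close> while \<open>n log\<^sub>p n = k n\<close>, and the ratio tends to \<open>1\<close>
  along the powers of \<open>p\<close>.
\<close>

section \<open>Multiplicities in factorials and binomial coefficients\<close>

lemma multiplicity_prod_nat:
  fixes f :: "'a \<Rightarrow> nat"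
  assumes "prime p" "finite A" "\<And>x. x \<in> A \<Longrightarrow> f x \<noteq> 0"
  shows "multiplicity p (prod f A) = (\<Sum>x\<in>A. multiplicity p (f x))"
  using assms(2,3)
  by (induction A rule: finite_induct)
     (use assms(1) in \<open>simp_all add: prime_elem_multiplicity_mult_distrib\<close>)

text \<open>The powers of \<open>p\<close> dividing \<open>m\<close> are exactly the \<open>p ^ i\<close> with \<open>i \<le> v m\<close>. The cutoff \<open>K\<close>
  is shared by all \<open>m < p ^ Suc K\<close>, so that such sums can be added term by term.\<close>

lemma multiplicity_eq_sum_dvd:
  fixes p m :: nat
  assumes p: "prime p" and m: "0 < m" "m < p ^ Suc K"
  shows "multiplicity p m = (\<Sum>i=1..K. if p ^ i dvd m then 1 else 0)"
proof -
  have p1: "1 < p" using p by (rule prime_gt_1_nat)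
  have dvd: "p ^ i dvd m \<longleftrightarrow> i \<le> multiplicity p m" for i
    using m p p1 by (intro power_dvd_iff_le_multiplicity) auto
  have "p ^ multiplicity p m \<le> m"
    using m by (intro dvd_imp_le multiplicity_dvd) auto
  hence "p ^ multiplicity p m < p ^ Suc K" using m by linarith
  hence "multiplicity p m \<le> K"
    using p1 power_less_imp_less_exp less_Suc_eq_le by blast
  hence "{i \<in> {1..K}. p ^ i dvd m} = {1..multiplicity p m}"
    by (auto simp: dvd)
  thus ?thesis
    by (simp add: sum.If_cases Int_def)
qed

text \<open>Legendre's formula. Passing from \<open>m\<close> to \<open>m + 1\<close> raises the quotient by \<open>p ^ i\<close> exactly when
  \<open>p ^ i\<close> divides \<open>m + 1\<close>.\<close>

lemma multiplicity_fact_legendre: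
  fixes p m :: nat
  assumes p: "prime p" and "m < p ^ Suc K"
  shows "multiplicity p (fact m :: nat) = (\<Sum>i=1..K. m div p ^ i)"
  using assms(2)
proof (induction m)
  case 0
  thus ?case by simp
next
  case (Suc m)
  have "multiplicity p (fact (Suc m) :: nat) = multiplicity p (Suc m * fact m)"
    by simp
  also have "\<dots> = multiplicity p (Suc m) + multiplicity p (fact m :: nat)"
    using p by (intro prime_elem_multiplicity_mult_distrib) auto
  also have "\<dots> = (\<Sum>i=1..K. (if p ^ i dvd Suc m then 1 else 0) + m div p ^ i)"
    using Suc multiplicity_eq_sum_dvd[OF p, of "Suc m" K] by (simp add: sum.distrib)
  also have "\<dots> = (\<Sum>i=1..K. Suc m div p ^ i)"
    by (intro sum.cong) (auto simp: div_Suc dvd_eq_mod_eq_0)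
  finally show ?case .
qed

text \<open>By Legendre's formula, each \<open>p ^ i \<le> n\<close> contributes to the multiplicity only the carry
  \<open>n div p ^ i - t div p ^ i - (n - t) div p ^ i \<le> 1\<close>.\<close>

lemma multiplicity_binomial_le:
  fixes p n t K :: nat
  assumes p: "prime p" and "t \<le> n" "n < p ^ Suc K"
  shows "multiplicity p (n choose t) \<le> K"
proof -
  let ?v = "\<lambda>m. multiplicity p (fact m :: nat)"
  have carry: "n div q \<le> t div q + (n - t) div q + 1" if q: "0 < q" for q
  proof -
    have "t mod q + (n - t) mod q < 2 * q"
      using mod_less_divisor[OF q, of t] mod_less_divisor[OF q, of "n - t"] by linarith
    hence "(t mod q + (n - t) mod q) div q \<le> 1"
      using q by (simp add: div_less_iff_less_mult flip: less_Suc_eq_le)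
    thus ?thesis using div_add1_eq[of t "n - t" q] assms(2) by simp
  qed
  have "fact n = fact t * fact (n - t) * (n choose t)"
    using assms by (simp add: binomial_fact_lemma)
  hence "?v n = multiplicity p (fact t * fact (n - t) * (n choose t))"
    by simp
  also have "\<dots> = ?v t + ?v (n - t) + multiplicity p (n choose t)"
    using p assms by (simp add: prime_elem_multiplicity_mult_distrib)
  finally have eq: "?v n = ?v t + ?v (n - t) + multiplicity p (n choose t)" .
  have "?v n = (\<Sum>i=1..K. n div p ^ i)"
    using assms by (intro multiplicity_fact_legendre)
  also have "\<dots> \<le> (\<Sum>i=1..K. t div p ^ i + (n - t) div p ^ i + 1)"
    using p by (intro sum_mono carry) (simp add: prime_gt_0_nat)
  also have "\<dots> = (\<Sum>i=1..K. t div p ^ i) + (\<Sum>i=1..K. (n - t) div p ^ i) + K"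
    unfolding sum.distrib by simp
  also have "\<dots> = ?v t + ?v (n - t) + K"
    using assms by (simp add: multiplicity_fact_legendre[OF p, of _ K])
  finally show ?thesis using eq by linarith
qed

text \<open>Legendre's formula gives the geometric sum \<open>p ^ (k - 1) + \<dots> + p + 1\<close> here.\<close>

lemma multiplicity_fact_prime_power_le:
  fixes p k :: nat
  assumes p: "prime p"
  shows "multiplicity p (fact (p ^ k) :: nat) \<le> p ^ k"
proof -
  have p2: "2 \<le> p" using p by (rule prime_ge_2_nat)
  have geo: "(\<Sum>i=1..k. p ^ k div p ^ i) \<le> p ^ k"
  proof (induction k)
    case (Suc k)
    have "(\<Sum>i=1..Suc k. p ^ Suc k div p ^ i) = p ^ k + (\<Sum>i=1..k. p ^ k div p ^ i)"
      using p2 by (simp add: sum.atLeast_Suc_atMost sum.shift_bounds_cl_Suc_ivl del: sum.cl_ivl_Suc)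
    also have "\<dots> \<le> 2 * p ^ k" using Suc by simp
    also have "\<dots> \<le> p ^ Suc k" using p2 by simp
    finally show ?case .
  qed simp
  have "p ^ k < p ^ Suc k" using p2 by simp
  from multiplicity_fact_legendre[OF p this] geo show ?thesis by simp
qed

section \<open>Multiplicities of the binomial products\<close>

lemma multiplicity_binomial_product:
  assumes "prime p"
  shows "multiplicity p (binomial_product n) = (\<Sum>t=1..n. multiplicity p (n choose t))"
  unfolding binomial_product_def using assms
  by (subst multiplicity_prod_nat) (simp_all add: sum.atLeast_Suc_atMost)

lemma multiplicity_binomial_product_le:
  fixes p n :: nat
  assumes p: "prime p" and n: "0 < n"
  shows "real (multiplicity p (binomial_product n)) \<le> real n * log (real p) (real n)"
proof -
  have p1: "1 < p" using p by (rule prime_gt_1_nat)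
  obtain K where K: "p ^ K \<le> n" "n < p ^ Suc K"
    using ex_power_ivl1[of p n] p1 n by auto
  have "multiplicity p (binomial_product n) \<le> (\<Sum>t=1..n. K)"
    unfolding multiplicity_binomial_product[OF p]
    using K by (intro sum_mono multiplicity_binomial_le[OF p]) auto
  hence "real (multiplicity p (binomial_product n)) \<le> real n * real K"
    by (metis card_atLeastAtMost diff_Suc_1 of_nat_mono of_nat_mult sum_constant of_nat_id)
  also have "real K \<le> log (real p) (real n)"
    using K p1 n by (simp add: le_log_iff powr_realpow flip: of_nat_power)
  finally show ?thesis by (simp add: mult_left_mono)
qed

lemma multiplicity_binomial_product_prime_power_ge:
  fixes p k :: nat
  assumes p: "prime p"
  shows "k * p ^ k \<le> multiplicity p (binomial_product (p ^ k)) + p ^ k"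
proof -
  define n where "n = p ^ k"
  have entry: "k \<le> multiplicity p t + multiplicity p (n choose t)" if t: "t \<in> {1..n}" for t
  proof -
    have "p ^ k dvd t * (n choose t)"
      using t by (simp add: times_binomial_minus1_eq n_def)
    hence "k \<le> multiplicity p (t * (n choose t))"
      using t p by (intro multiplicity_geI) (auto simp: prime_gt_1_nat)
    also have "\<dots> = multiplicity p t + multiplicity p (n choose t)"
      using t p by (intro prime_elem_multiplicity_mult_distrib) auto
    finally show ?thesis .
  qed
  have "k * n = (\<Sum>t=1..n. k)" by simp
  also have "\<dots> \<le> (\<Sum>t=1..n. multiplicity p t + multiplicity p (n choose t))"
    by (intro sum_mono entry)
  also have "\<dots> = multiplicity p (fact n :: nat) + multiplicity p (binomial_product n)"
    unfolding sum.distrib multiplicity_binomial_product[OF p] fact_prod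
    using multiplicity_prod_nat[OF p, of "{1..n}" "\<lambda>t. t"] by simp
  also have "multiplicity p (fact n :: nat) \<le> n"
    unfolding n_def by (rule multiplicity_fact_prime_power_le[OF p])
  finally show ?thesis by (simp add: n_def)
qed

section \<open>The limit superior\<close>

theorem mainTheorem11:
  fixes p :: nat
  assumes "prime p"
  shows "limsup (\<lambda>n. ereal (real (multiplicity p (binomial_product n)) /
           (real n * log (real p) (real n)))) = 1"
proof -
  have p1: "1 < p" using assms by (rule prime_gt_1_nat)
  define f where "f n = real (multiplicity p (binomial_product n)) /
           (real n * log (real p) (real n))" for n
  have "f n \<le> 1" if n: "n > 1" for n
  proof -
    have "0 < real n * log (real p) (real n)" using n p1 by simp
    thus ?thesis
      using multiplicity_binomial_product_le[OF assms, of n] n by (simp add: f_def divide_le_eq_1)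
  qed
  hence "eventually (\<lambda>n. ereal (f n) \<le> 1) sequentially"
    by (intro eventually_mono[OF eventually_gt_at_top[of 1]]) auto
  hence upper: "limsup (\<lambda>n. ereal (f n)) \<le> 1"
    by (rule Limsup_bounded)

  have "1 - 1 / real k \<le> f (p ^ k)" if k: "k > 0" for k
  proof -
    have "real (k * p ^ k) \<le> real (multiplicity p (binomial_product (p ^ k)) + p ^ k)"
      using multiplicity_binomial_product_prime_power_ge[OF assms] by (intro of_nat_mono)
    hence "(real k - 1) * real (p ^ k) \<le> real (multiplicity p (binomial_product (p ^ k)))"
      by (simp add: algebra_simps)
    hence "(real k - 1) * real (p ^ k) / (real (p ^ k) * real k)
        \<le> real (multiplicity p (binomial_product (p ^ k))) / (real (p ^ k) * real k)"
      by (intro divide_right_mono) auto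
    also have "(real k - 1) * real (p ^ k) / (real (p ^ k) * real k) = 1 - 1 / real k"
      using k p1 by (simp add: field_simps)
    finally have ratio: "1 - 1 / real k
        \<le> real (multiplicity p (binomial_product (p ^ k))) / (real (p ^ k) * real k)" .
    have "log (real p) (real (p ^ k)) = real k"
      using p1 by (simp add: log_nat_power)
    with ratio show ?thesis unfolding f_def by (simp only:)
  qed
  hence "eventually (\<lambda>k. ereal (1 - 1 / real k) \<le> ereal (f (p ^ k))) sequentially"
    by (intro eventually_mono[OF eventually_gt_at_top[of 0]]) auto
  hence "limsup (\<lambda>k. ereal (1 - 1 / real k)) \<le> limsup (\<lambda>k. ereal (f (p ^ k)))"
    by (rule Limsup_mono)
  moreover have "(\<lambda>k. 1 - 1 / real k) \<longlonglongrightarrow> 1 - 0"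
    by (intro tendsto_intros lim_1_over_n)
  hence "limsup (\<lambda>k. ereal (1 - 1 / real k)) = 1"
    by (intro lim_imp_Limsup) (auto simp: one_ereal_def)
  moreover have "strict_mono (\<lambda>k. p ^ k)"
    using p1 by (intro strict_monoI power_strict_increasing)
  hence "limsup (\<lambda>k. ereal (f (p ^ k))) \<le> limsup (\<lambda>n. ereal (f n))"
    using limsup_subseq_mono[of "\<lambda>k. p ^ k" "\<lambda>n. ereal (f n)"] by (simp add: o_def)
  ultimately have "1 \<le> limsup (\<lambda>n. ereal (f n))" by simp
  with upper show ?thesis unfolding f_def by (rule antisym)
qed

end
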